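(* (1) For every $1\le m\le d-1$, the word $l_m$ is the only word appearing at stage $m$. (2) For every $m\ge d$, $l_m$ is the longest word appearing at stage $m$. (3) For every $m\in\mathbb N$, the image under $f_0$ of every branch vertex of $T_m^s$ is a suffix of $l_m$. (4) For every $m\in\mathbb N$, every suffix of $l_m$ has appeared at some stage $\le m$.
   Context: Let $d\ge 3$, $A=\{1,\dots,d\}$, and let $\sigma$ be the substitution (morphism of the free monoid $A^*$) $\sigma(1)=12$, $\sigma(k)=k+1$ for $2\le k\le d-1$, $\sigma(d)=1$; $\sigma$ is also regarded as an automorphism of the free group $F_d$ with basis $A$ (elements are reduced words over $A\cup A^{-1}$, $\epsilon$ is the empty word; suffixes, possibly empty, are suffixes of reduced words, and length is reduced length). Let $A_\tau=\{1,\dots,2d-2\}$. Trees have oriented edges $(x,y,i)$ (from $x$ to $y$) coloured by $i\in A_\tau$. The tree substitution $\tau$ replaces each edge as follows, keeping its endpoints: $(x,y,1)\mapsto(x,y,d)$; $(x,y,i)\mapsto(x,y,i-1)$ for $3\le i\le d$ and for $d+2\le i\le 2d-2$; $(x,y,d+1)\mapsto(x,y,1)$; and $(x,y,2)$ is replaced by the $d$ edges $(z,x,d)$, $(z,y,1)$ and $(z,z_h,d+h)$ for $1\le h\le d-2$, where $z,z_1,\dots,z_{d-2}$ are new vertices. $T_0^s$ is the tree with root $x_0$ and edges $(x_0,x_j,j)$, $1\le j\le d$, and $T_n^s=\tau^n(T_0^s)$; vertices of $T_n^s$ are vertices of $T_{n+1}^s$. Branch vertices are those of degree $d$ (all others have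 degree $1$). For vertices $x,x'$ of $T_n^s$, $\gamma_n(x,x')$ is the word in $(A_\tau\cup\overline{A_\tau})^*$ read along the shortest path from $x$ to $x'$, an edge of colour $i$ contributing $i$ if traversed along its orientation and $\overline i$ otherwise. The morphism $p_*:(A_\tau\cup\overline{A_\tau})^*\to F_d$ is given by $p_*(k)=k$ for $1\le k\le d$, $p_*(d+k)=\sigma^k(1)$ for $1\le k\le d-2$, $p_*(\overline k)=p_*(k)^{-1}$. For a branch vertex $x$ of some $T_k^s$, $f_0(x)=\sigma^k(p_*(\gamma_k(x_0,x)))\in F_d$ (independent of the choice of $k$). A word $u^{-1}$ appears at stage $k\ge1$ if $u^{-1}=f_0(x)$ for some branch vertex $x$ of $T_k^s$ that is not a vertex of $T_{k-1}^s$; by convention $\epsilon$ appears at stage $-(d-2)$ and no other word appears at a stage $\le0$. The words $l_m$: $l_0=\epsilon$; $l_m=\sigma^{m-1}(1^{-1})$ for $1\le m\le d-1$; for $m\ge d$, $l_m=\sigma^{\alpha_0}(1^{-1})\cdots\sigma^{\alpha_n}(1^{-1})$, where $\alpha_0\in\{0,\dots,d-2\}$ is the residue of $m-1$ modulo $d-1$, $\alpha_i=\alpha_{i-1}+(d-1)$ for $1\le i\le n$, and $\alpha_n=m-1$. (The words $l_m$, $m\ge1$, are exactly the inverses of the nonempty bispecial factors of $\lim_n\sigma^n(1)$.) *)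

theory Defs
  imports Main "HOL-Library.Sublist"
begin

section \<open>Free groups\<close>

text \<open>
  A signed word is a word over an alphabet and its formal inverses: \<open>(a, True)\<close> stands for \<open>a\<close> and
  \<open>(a, False)\<close> for the inverse of \<open>a\<close>. Elements of a free group are the reduced signed words.
\<close>

type_synonym 'a sword = "('a \<times> bool) list"

fun cons_red :: "'a \<times> bool \<Rightarrow> 'a sword \<Rightarrow> 'a sword" where
  "cons_red a [] = [a]"
| "cons_red a (b # w) = (if fst a = fst b \<and> snd a \<noteq> snd b then w else a # b # w)"

definition reduce :: "'a sword \<Rightarrow> 'a sword" where
  "reduce w = foldr cons_red w []"

definition fg_mult :: "'a sword \<Rightarrow> 'a sword \<Rightarrow> 'a sword" where
  "fg_mult u v = reduce (u @ v)"

definition fg_prod :: "'a sword list \<Rightarrow> 'a sword" where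
  "fg_prod us = foldr fg_mult us []"

definition fg_inv :: "'a sword \<Rightarrow> 'a sword" where
  "fg_inv w = rev (map (\<lambda>(a, s). (a, \<not> s)) w)"

text \<open>The morphism from signed words to the free group that sends each letter \<open>a\<close> to \<open>f a\<close>.\<close>

definition fg_lift :: "('a \<Rightarrow> 'b sword) \<Rightarrow> 'a sword \<Rightarrow> 'b sword" where
  "fg_lift f w = fg_prod (map (\<lambda>(a, s). if s then f a else fg_inv (f a)) w)"


section \<open>The substitution\<close>

definition sigma_letter :: "nat \<Rightarrow> nat \<Rightarrow> nat sword" where
  "sigma_letter d k =
    (if k = 1 then [(1, True), (2, True)] else if k = d then [(1, True)] else [(k + 1, True)])"

definition sigma :: "nat \<Rightarrow> nat sword \<Rightarrow> nat sword" where
  "sigma d = fg_lift (sigma_letter d)"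

definition l :: "nat \<Rightarrow> nat \<Rightarrow> nat sword" where
  "l d m =
    (if m = 0 then []
     else if m \<le> d - 1 then (sigma d ^^ (m - 1)) [(1, False)]
     else fg_prod (map (\<lambda>i. (sigma d ^^ ((m - 1) mod (d - 1) + i * (d - 1))) [(1, False)])
                       [0..<(m - 1) div (d - 1) + 1]))"


section \<open>The tree substitution\<close>

text \<open>
  \<open>Base j\<close> is the vertex \<open>x\<^sub>j\<close> of the initial tree. \<open>New x y 0\<close> and \<open>New x y h\<close>, for \<open>h \<ge> 1\<close>, are
  the vertices \<open>z\<close> and \<open>z\<^sub>h\<close> created by the replacement of the edge \<open>(x, y, 2)\<close>. That these are
  indeed new vertices is the lemma \<open>New_fresh\<close> below.
\<close>

datatype vertex = Base nat | New vertex vertex nat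

text \<open>An edge \<open>(x, y, i)\<close> goes from \<open>x\<close> to \<open>y\<close> and has colour \<open>i\<close>. A tree is given by its edges.\<close>

type_synonym edge = "vertex \<times> vertex \<times> nat"

fun tau_edge :: "nat \<Rightarrow> edge \<Rightarrow> edge set" where
  "tau_edge d (x, y, i) =
    (if i = 1 then {(x, y, d)}
     else if i = 2 then
       {(New x y 0, x, d), (New x y 0, y, 1)} \<union> {(New x y 0, New x y h, d + h) | h. 1 \<le> h \<and> h \<le> d - 2}
     else if i = d + 1 then {(x, y, 1)}
     else {(x, y, i - 1)})"

definition tau :: "nat \<Rightarrow> edge set \<Rightarrow> edge set" where
  "tau d E = (\<Union>e\<in>E. tau_edge d e)"

definition T0 :: "nat \<Rightarrow> edge set" where
  "T0 d = {(Base 0, Base j, j) | j. 1 \<le> j \<and> j \<le> d}"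

definition T :: "nat \<Rightarrow> nat \<Rightarrow> edge set" where
  "T d n = (tau d ^^ n) (T0 d)"

definition verts :: "edge set \<Rightarrow> vertex set" where
  "verts E = {v. \<exists>x y i. (x, y, i) \<in> E \<and> (v = x \<or> v = y)}"

definition degree :: "edge set \<Rightarrow> vertex \<Rightarrow> nat" where
  "degree E v = card {(x, y, i). (x, y, i) \<in> E \<and> (v = x \<or> v = y)}"

definition branch_verts :: "nat \<Rightarrow> nat \<Rightarrow> vertex set" where
  "branch_verts d n = {v \<in> verts (T d n). degree (T d n) v = d}"

inductive walk :: "edge set \<Rightarrow> vertex \<Rightarrow> nat sword \<Rightarrow> vertex \<Rightarrow> bool" for E where
  walk_Nil: "walk E x [] x"
| walk_fwd: "(x, y, i) \<in> E \<Longrightarrow> walk E y w z \<Longrightarrow> walk E x ((i, True) # w) z"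
| walk_bwd: "(y, x, i) \<in> E \<Longrightarrow> walk E y w z \<Longrightarrow> walk E x ((i, False) # w) z"

text \<open>The word read along the shortest path, which is unique in a tree.\<close>

definition gamma :: "nat \<Rightarrow> nat \<Rightarrow> vertex \<Rightarrow> vertex \<Rightarrow> nat sword" where
  "gamma d n x y = (ARG_MIN length w. walk (T d n) x w y)"


section \<open>The map to the free group\<close>

definition p_letter :: "nat \<Rightarrow> nat \<Rightarrow> nat sword" where
  "p_letter d i = (if i \<le> d then [(i, True)] else (sigma d ^^ (i - d)) [(1, True)])"

definition p_star :: "nat \<Rightarrow> nat sword \<Rightarrow> nat sword" where
  "p_star d = fg_lift (p_letter d)"

text \<open>The value of \<open>f0 d x\<close> does not depend on the stage \<open>k\<close> with \<open>x \<in> branch_verts d k\<close>.\<close>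

definition f0 :: "nat \<Rightarrow> vertex \<Rightarrow> nat sword" where
  "f0 d x = (let k = (LEAST k. x \<in> branch_verts d k)
             in (sigma d ^^ k) (p_star d (gamma d k (Base 0) x)))"

definition appears :: "nat \<Rightarrow> int \<Rightarrow> nat sword \<Rightarrow> bool" where
  "appears d k w \<longleftrightarrow>
    (if k \<ge> 1 then \<exists>x \<in> branch_verts d (nat k). x \<notin> verts (T d (nat k - 1)) \<and> w = f0 d x
     else k = - (int d - 2) \<and> w = [])"


section \<open>Created vertices are new\<close>

definition fresh_inv :: "edge set \<Rightarrow> bool" where
  "fresh_inv E \<longleftrightarrow>
    (\<forall>x y h. New x y h \<in> verts E \<longrightarrow> x \<in> verts E \<and> (\<forall>i. (x, y, i) \<notin> E)) \<and>
    (\<forall>x y i j. (x, y, i) \<in> E \<longrightarrow> (x, y, j) \<in> E \<longrightarrow> i = j) \<and>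
    (\<forall>x i. (x, x, i) \<notin> E)"

lemma New_neq [simp]: "New x y h \<noteq> x" "New x y h \<noteq> y" "x \<noteq> New x y h" "y \<noteq> New x y h"
proof -
  show "New x y h \<noteq> x" "New x y h \<noteq> y"
    using size_neq_size_imp_neq[of "New x y h" x] size_neq_size_imp_neq[of "New x y h" y] by auto
  then show "x \<noteq> New x y h" "y \<noteq> New x y h" by metis+
qed

lemma in_tau_cases:
  assumes "(x, y, i) \<in> tau d E"
  obtains (keep) j where "(x, y, j) \<in> E" "j \<noteq> 2" "i = (if j = 1 then d else if j = d + 1 then 1 else j - 1)"
  | (source) b where "(y, b, 2) \<in> E" "x = New y b 0" "i = d"
  | (target) a where "(a, y, 2) \<in> E" "x = New a y 0" "i = 1"
  | (leaf) a b h where "(a, b, 2) \<in> E" "x = New a b 0" "y = New a b h" "1 \<le> h" "i = d + h"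
  using assms unfolding tau_def by (auto split: if_splits)

lemma verts_tau:
  assumes "v \<in> verts (tau d E)"
  shows "v \<in> verts E \<or> (\<exists>a b h. (a, b, 2) \<in> E \<and> v = New a b h)"
proof -
  obtain x y i where e: "(x, y, i) \<in> tau d E" and v: "v = x \<or> v = y"
    using assms by (auto simp: verts_def)
  from e show ?thesis
    by (cases rule: in_tau_cases) (use v in \<open>auto simp: verts_def\<close>)
qed

lemma verts_mono_tau: "verts E \<subseteq> verts (tau d E)"
proof
  fix v assume "v \<in> verts E"
  then obtain x y i where e: "(x, y, i) \<in> E" and v: "v = x \<or> v = y"
    by (auto simp: verts_def)
  have "\<exists>a b j. (a, b, j) \<in> tau_edge d (x, y, i) \<and> (v = a \<or> v = b)"
    using v by auto
  then show "v \<in> verts (tau d E)"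
    using e unfolding verts_def tau_def by blast
qed

lemma fresh_inv_tau:
  assumes "fresh_inv E"
  shows "fresh_inv (tau d E)"
proof -
  have A: "\<And>x y h i. New x y h \<in> verts E \<Longrightarrow> (x, y, i) \<notin> E"
    and S: "\<And>x y h. New x y h \<in> verts E \<Longrightarrow> x \<in> verts E"
    and B: "\<And>x y i j. (x, y, i) \<in> E \<Longrightarrow> (x, y, j) \<in> E \<Longrightarrow> i = j"
    and C: "\<And>x i. (x, x, i) \<notin> E"
    using assms unfolding fresh_inv_def by blast+
  have V: "x \<in> verts E" "y \<in> verts E" if "(x, y, i) \<in> E" for x y i
    using that by (auto simp: verts_def)
  have N: "New a b h \<notin> verts E" if "(a, b, 2) \<in> E" for a b h
    using A that by blast
  have NE: "(New a b h, y, i) \<notin> E" if "(a, b, 2) \<in> E" for a b h y i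
    using N V that by blast
  have old: "x \<in> verts E" if "New x y h \<in> verts (tau d E)" for x y h
    using verts_tau[OF that] S V by blast
  have no_edge: "(x, y, i) \<notin> tau d E" if "New x y h \<in> verts (tau d E)" for x y h i
  proof
    assume "(x, y, i) \<in> tau d E"
    then show False
    proof (cases rule: in_tau_cases)
      case (keep j)
      then show False using verts_tau[OF that] A B by blast
    qed (use N old[OF that] in blast)+
  qed
  have unique: "i = j" if "(x, y, i) \<in> tau d E" "(x, y, j) \<in> tau d E" for x y i j
    using that(1)
  proof (cases rule: in_tau_cases)
    case keep1: (keep i')
    from that(2) show ?thesis
      by (cases rule: in_tau_cases) (use keep1 B NE in blast)+
  next
    case source1: (source b)
    from that(2) show ?thesis
      by (cases rule: in_tau_cases) (use source1 C NE in auto)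
  next
    case target1: (target a)
    from that(2) show ?thesis
      by (cases rule: in_tau_cases) (use target1 C NE in auto)
  next
    case leaf1: (leaf a b h)
    from that(2) show ?thesis
      by (cases rule: in_tau_cases) (use leaf1 NE in auto)
  qed
  have no_loop: "(x, x, i) \<notin> tau d E" for x i
  proof
    assume "(x, x, i) \<in> tau d E"
    then show False
      by (cases rule: in_tau_cases) (use C in auto)
  qed
  show ?thesis
    unfolding fresh_inv_def using no_edge unique no_loop old verts_mono_tau by blast
qed

lemma New_fresh:
  assumes "(x, y, 2) \<in> T d n"
  shows "New x y h \<notin> verts (T d n)"
proof -
  have "fresh_inv (T d n)"
  proof (induction n)
    case 0
    show ?case by (auto simp: T_def T0_def fresh_inv_def verts_def)
  next
    case (Suc n)
    then show ?case using fresh_inv_tau by (simp add: T_def)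
  qed
  then show ?thesis
    using assms unfolding fresh_inv_def by blast
qed

end

(*
  Every outgoing edge of a branch vertex acquires colour 2 exactly once, at d consecutive stages, so
  a branch vertex created at stage k has exactly one child at each of the stages k + d - 1, ...,
  k + 2d - 2, and a child created at stage s multiplies f0 by the inverse of W (s - 1), where
  W n = sigma^n(1). Hence the inverses of the values of f0 are the positive words
  W a_1 ... W a_r with a_r <= d - 1 and a_i - a_(i+1) between d - 1 and 2d - 2. The inverse of l_m is
  the greedy one among these words, with all gaps equal to d - 1, and the recurrence
  W (n + 1) = W n W (n - d + 1) shows that these greedy words are prefixes of one another and that
  the words of the above form are exactly their prefixes.
*)
theory Submission
  imports Defs
begin

section \<open>Free groups\<close>

definition reduced :: "'a sword \<Rightarrow> bool" where
  "reduced = successively (\<lambda>a b. \<not> (fst a = fst b \<and> snd a \<noteq> snd b))"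

lemma reduced_cons_red: "reduced r \<Longrightarrow> reduced (cons_red a r)"
  by (cases r) (auto simp: reduced_def successively_Cons)

lemma reduced_foldr: "reduced r \<Longrightarrow> reduced (foldr cons_red w r)"
  by (induction w) (auto simp: reduced_cons_red)

lemma reduced_reduce: "reduced (reduce w)"
  unfolding reduce_def by (rule reduced_foldr) (simp add: reduced_def)

lemma reduce_reduced: "reduced w \<Longrightarrow> reduce w = w"
proof (induction w)
  case Nil
  then show ?case by (simp add: reduce_def)
next
  case (Cons a w)
  then have "reduce w = w" by (auto simp: reduced_def successively_Cons)
  then have "reduce (a # w) = cons_red a w" by (simp add: reduce_def)
  also have "\<dots> = a # w" using Cons.prems by (cases w) (auto simp: reduced_def)
  finally show ?case .
qed

lemma reduce_reduce [simp]: "reduce (reduce w) = reduce w"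
  by (simp add: reduce_reduced reduced_reduce)

lemma reduce_Nil [simp]: "reduce [] = []"
  by (simp add: reduce_def)

lemma reduce_append: "reduce (u @ v) = foldr cons_red u (reduce v)"
  by (simp add: reduce_def)

lemma reduce_append_right [simp]: "reduce (u @ reduce v) = reduce (u @ v)"
  by (simp add: reduce_append)

text \<open>If \<open>b\<close> cancels the head of \<open>r\<close>, then \<open>a\<close> equals
  that head and is put back; reducedness of \<open>r\<close> keeps it from cancelling against the
  next letter.\<close>

lemma cons_red_cancel:
  assumes "reduced r" "fst a = fst b" "snd a \<noteq> snd b"
  shows "cons_red a (cons_red b r) = r"
proof (cases r)
  case Nil
  then show ?thesis using assms by simp
next
  case (Cons c r')
  have "a = c" if "fst b = fst c" "snd b \<noteq> snd c"
    using that assms by (auto simp: prod_eq_iff)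
  then show ?thesis
    using Cons assms by (cases r') (auto simp: reduced_def)
qed

text \<open>Letters act on reduced words by \<open>cons_red\<close>, and inverse letters act
  inversely. Hence a word and its reduction act alike, which is the source of associativity of
  \<open>fg_mult\<close>.\<close>

lemma foldr_cons_red:
  assumes "reduced r"
  shows "foldr cons_red (cons_red a u) r = cons_red a (foldr cons_red u r)"
proof (cases u)
  case (Cons b u')
  then show ?thesis
    using cons_red_cancel[OF reduced_foldr[OF assms], of a b] by auto
qed simp

lemma reduce_append_left [simp]: "reduce (reduce u @ v) = reduce (u @ v)"
proof -
  have "foldr cons_red (reduce u) (reduce v) = foldr cons_red u (reduce v)"
    by (induction u) (simp_all add: reduce_def foldr_cons_red reduced_foldr
        reduced_reduce[unfolded reduce_def])
  then show ?thesis by (simp add: reduce_append)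
qed

lemma fg_mult_assoc: "fg_mult (fg_mult u v) w = fg_mult u (fg_mult v w)"
  by (simp add: fg_mult_def)

lemma reduce_fg_mult [simp]: "reduce (fg_mult u v) = fg_mult u v"
  by (simp add: fg_mult_def)

lemma fg_mult_Nil: "reduce u = u \<Longrightarrow> fg_mult u [] = u" "reduce u = u \<Longrightarrow> fg_mult [] u = u"
  by (simp_all add: fg_mult_def)

lemma fg_inv_append: "fg_inv (u @ v) = fg_inv v @ fg_inv u"
  by (simp add: fg_inv_def)

lemma fg_inv_Nil [simp]: "fg_inv [] = []"
  by (simp add: fg_inv_def)

lemma fg_inv_inv [simp]: "fg_inv (fg_inv u) = u"
  by (simp add: fg_inv_def rev_map case_prod_unfold comp_def)

lemma length_fg_inv [simp]: "length (fg_inv u) = length u"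
  by (simp add: fg_inv_def)

lemma suffix_fg_inv: "suffix (fg_inv u) (fg_inv v) \<longleftrightarrow> prefix u v"
proof
  assume "prefix u v"
  then show "suffix (fg_inv u) (fg_inv v)"
    by (auto simp: prefix_def suffix_def fg_inv_append)
next
  assume "suffix (fg_inv u) (fg_inv v)"
  then obtain z where "fg_inv v = z @ fg_inv u" by (auto simp: suffix_def)
  then have "fg_inv (fg_inv v) = u @ fg_inv z" by (simp add: fg_inv_append)
  then show "prefix u v" by simp
qed

lemma reduce_append_fg_inv: "reduce (u @ fg_inv u) = []"
proof (induction u rule: rev_induct)
  case (snoc a u)
  have "reduce ([a] @ fg_inv [a]) = []"
    by (cases a) (simp add: fg_inv_def reduce_def)
  then have "reduce (u @ ([a] @ fg_inv [a]) @ fg_inv u) = reduce (u @ fg_inv u)"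
    by (metis append_Nil reduce_append_left reduce_append_right)
  then show ?case using snoc by (simp add: fg_inv_append)
qed simp

lemma fg_mult_inv_right: "fg_mult u (fg_inv u) = []"
  by (simp add: fg_mult_def reduce_append_fg_inv)

lemma fg_mult_inv_left: "fg_mult (fg_inv u) u = []"
  using fg_mult_inv_right[of "fg_inv u"] by simp

lemma fg_prod_eq: "fg_prod us = reduce (concat us)"
  by (induction us) (auto simp: fg_prod_def fg_mult_def)

section \<open>Morphisms of free groups\<close>

definition letter_image :: "('a \<Rightarrow> 'b sword) \<Rightarrow> 'a \<times> bool \<Rightarrow> 'b sword" where
  "letter_image f a = (if snd a then f (fst a) else fg_inv (f (fst a)))"

lemma fg_lift_eq: "fg_lift f w = reduce (concat (map (letter_image f) w))"
  by (simp add: fg_lift_def fg_prod_eq letter_image_def[abs_def] case_prod_unfold)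

lemma reduce_fg_lift [simp]: "reduce (fg_lift f w) = fg_lift f w"
  by (simp add: fg_lift_eq)

lemma fg_lift_append: "fg_lift f (u @ v) = fg_mult (fg_lift f u) (fg_lift f v)"
  by (simp add: fg_lift_eq fg_mult_def)

lemma letter_image_cancel:
  assumes "fst a = fst b" "snd a \<noteq> snd b"
  shows "reduce (letter_image f a @ letter_image f b) = []"
  using assms reduce_append_fg_inv[of "f (fst a)"] reduce_append_fg_inv[of "fg_inv (f (fst a))"]
  by (auto simp: letter_image_def)

text \<open>Cancelling letters have cancelling images. This makes \<open>fg_lift f\<close> depend
  only on the reduction of its argument, hence a homomorphism.\<close>

lemma fg_lift_cons_red: "fg_lift f (cons_red a w) = fg_lift f (a # w)"
proof (cases w)
  case (Cons b w')
  show ?thesis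
  proof (cases "fst a = fst b \<and> snd a \<noteq> snd b")
    case True
    have "reduce ((letter_image f a @ letter_image f b) @ concat (map (letter_image f) w'))
        = reduce (concat (map (letter_image f) w'))"
      by (metis True append_Nil letter_image_cancel reduce_append_left)
    then show ?thesis using True Cons by (simp add: fg_lift_eq)
  qed (use Cons in auto)
qed simp

lemma fg_lift_reduce [simp]: "fg_lift f (reduce w) = fg_lift f w"
proof (induction w)
  case (Cons a w)
  have "fg_lift f (reduce (a # w)) = fg_lift f (a # reduce w)"
    by (simp add: reduce_def fg_lift_cons_red)
  also have "\<dots> = fg_lift f (a # w)"
    using Cons fg_lift_append[of f "[a]"] by (metis append_Cons append_Nil)
  finally show ?case .
qed simp

lemma fg_lift_mult: "fg_lift f (fg_mult u v) = fg_mult (fg_lift f u) (fg_lift f v)"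
  by (simp add: fg_mult_def[of u] fg_lift_append)

lemma fg_lift_inv:
  "fg_lift f (fg_inv w) = reduce (fg_inv (concat (map (letter_image f) w)))"
proof -
  have "concat (map (letter_image f) (fg_inv w)) = fg_inv (concat (map (letter_image f) w))"
    by (induction w) (auto simp: fg_inv_def letter_image_def rev_map case_prod_unfold comp_def)
  then show ?thesis by (simp add: fg_lift_eq)
qed

section \<open>Positive words\<close>

lemma reduce_same_sign: "\<forall>a\<in>set w. snd a = s \<Longrightarrow> reduce w = w"
proof (induction w)
  case (Cons a w)
  then have "reduce (a # w) = cons_red a w" by (simp add: reduce_def)
  also have "\<dots> = a # w" using Cons.prems by (cases w) auto
  finally show ?case .
qed simp

text \<open>Nothing cancels inside a positive word or its inverse, so for such words the
  substitution can be computed in the free monoid.\<close>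

definition positive :: "'a sword \<Rightarrow> bool" where
  "positive w \<longleftrightarrow> (\<forall>a\<in>set w. snd a)"

lemma positive_append [simp]: "positive (u @ v) \<longleftrightarrow> positive u \<and> positive v"
  by (auto simp: positive_def)

lemma positive_Nil [simp]: "positive []"
  by (simp add: positive_def)

lemma reduce_positive: "positive w \<Longrightarrow> reduce w = w"
  by (rule reduce_same_sign[of _ True]) (auto simp: positive_def)

lemma reduce_fg_inv_positive: "positive w \<Longrightarrow> reduce (fg_inv w) = fg_inv w"
  by (rule reduce_same_sign[of _ False]) (auto simp: positive_def fg_inv_def)

section \<open>The substitution\<close>

lemma positive_sigma_letter: "positive (sigma_letter d k)"
  by (simp add: positive_def sigma_letter_def)

lemma concat_letter_image_positive:
  assumes "positive w"
  shows "concat (map (letter_image (sigma_letter d)) w) = concat (map (sigma_letter d \<circ> fst) w)"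
  using assms by (induction w) (auto simp: positive_def letter_image_def)

lemma positive_concat_sigma: "positive (concat (map (sigma_letter d \<circ> fst) w))"
  by (induction w) (auto simp: positive_sigma_letter)

lemma sigma_positive: "positive w \<Longrightarrow> sigma d w = concat (map (sigma_letter d \<circ> fst) w)"
  by (simp add: sigma_def fg_lift_eq concat_letter_image_positive positive_concat_sigma reduce_positive)

lemma positive_sigma: "positive w \<Longrightarrow> positive (sigma d w)"
  by (simp add: sigma_positive positive_concat_sigma)

lemma positive_sigma_pow: "positive w \<Longrightarrow> positive ((sigma d ^^ n) w)"
  by (induction n) (auto simp: positive_sigma)

lemma sigma_pow_append:
  "positive u \<Longrightarrow> positive v \<Longrightarrow> (sigma d ^^ n) (u @ v) = (sigma d ^^ n) u @ (sigma d ^^ n) v"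
  by (induction n) (auto simp: sigma_positive positive_sigma_pow)

lemma sigma_fg_inv: "positive w \<Longrightarrow> sigma d (fg_inv w) = fg_inv (sigma d w)"
  by (simp add: sigma_def fg_lift_inv fg_lift_eq[of _ w] concat_letter_image_positive
      positive_concat_sigma reduce_positive reduce_fg_inv_positive)

lemma sigma_pow_fg_inv: "positive w \<Longrightarrow> (sigma d ^^ n) (fg_inv w) = fg_inv ((sigma d ^^ n) w)"
  by (induction n) (auto simp: sigma_fg_inv positive_sigma_pow)

lemma sigma_pow_mult:
  "(sigma d ^^ n) (fg_mult u v) = fg_mult ((sigma d ^^ n) u) ((sigma d ^^ n) v)"
  by (induction n) (simp_all add: sigma_def fg_lift_mult)

lemma sigma_pow_Nil [simp]: "(sigma d ^^ n) [] = []"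
  by (induction n) (simp_all add: sigma_def fg_lift_eq)

lemma reduce_sigma_pow: "reduce w = w \<Longrightarrow> reduce ((sigma d ^^ n) w) = (sigma d ^^ n) w"
  by (cases n) (simp_all add: sigma_def)

section \<open>The words \<open>W d n\<close> and their recurrence\<close>

definition W :: "nat \<Rightarrow> nat \<Rightarrow> nat sword" where
  "W d n = (sigma d ^^ n) [(1, True)]"

lemma positive_letter [simp]: "positive [(k, True)]"
  by (simp add: positive_def)

lemma positive_W [simp]: "positive (W d n)"
  by (simp add: W_def positive_sigma_pow)

lemma W_0: "W d 0 = [(1, True)]"
  by (simp add: W_def)

lemma sigma_pow_W: "(sigma d ^^ m) (W d n) = W d (m + n)"
  by (simp add: W_def funpow_add)

lemma sigma_pow_neg: "(sigma d ^^ n) [(1, False)] = fg_inv (W d n)"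
  using sigma_pow_fg_inv[of "[(1, True)]" n d] by (simp add: W_def fg_inv_def)

lemma sigma_letter_pos: "sigma d [(k, True)] = sigma_letter d k"
  using sigma_positive[of "[(k, True)]" d] by simp

text \<open>The letter 2 climbs to d in d - 2 steps and then becomes 1, after which its images are
  the words \<open>W\<close>.\<close>

lemma sigma_pow_two:
  assumes "d \<ge> 3"
  shows "n \<le> d - 2 \<Longrightarrow> (sigma d ^^ n) [(2, True)] = [(n + 2, True)]"
    and "n \<ge> d - 1 \<Longrightarrow> (sigma d ^^ n) [(2, True)] = W d (n - (d - 1))"
proof -
  show small: "(sigma d ^^ n) [(2, True)] = [(n + 2, True)]" if "n \<le> d - 2" for n
    using that assms by (induction n) (auto simp: sigma_letter_pos sigma_letter_def)
  have *: "(sigma d ^^ (d - 1)) [(2, True)] = [(1, True)]"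
  proof -
    have "(sigma d ^^ Suc (d - 2)) [(2, True)] = sigma d [(d, True)]"
      using small[of "d - 2"] assms le_add_diff_inverse2[of 2 d]
      by (simp del: le_add_diff_inverse2)
    moreover have "Suc (d - 2) = d - 1" using assms by simp
    ultimately show ?thesis using assms by (simp add: sigma_letter_pos sigma_letter_def)
  qed
  assume "n \<ge> d - 1"
  then have "(sigma d ^^ n) [(2, True)]
      = (sigma d ^^ (n - (d - 1))) ((sigma d ^^ (d - 1)) [(2, True)])"
    by (metis comp_apply funpow_add le_add_diff_inverse2)
  then show "(sigma d ^^ n) [(2, True)] = W d (n - (d - 1))"
    by (simp only: * W_def)
qed

lemma W_Suc: "W d (Suc n) = W d n @ (sigma d ^^ n) [(2, True)]"
proof -
  have "W d (Suc n) = (sigma d ^^ n) (sigma d [(1, True)])"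
    by (simp add: W_def funpow_swap1)
  also have "sigma d [(1, True)] = [(1, True)] @ [(2, True)]"
    by (simp add: sigma_letter_pos sigma_letter_def)
  finally show ?thesis
    by (simp only: sigma_pow_append positive_letter W_def)
qed

lemma W_Suc_small: "d \<ge> 3 \<Longrightarrow> n < d - 1 \<Longrightarrow> W d (Suc n) = W d n @ [(n + 2, True)]"
  using W_Suc[of d n] sigma_pow_two(1)[of d n] by auto

lemma W_Suc_large: "d \<ge> 3 \<Longrightarrow> n \<ge> d - 1 \<Longrightarrow> W d (Suc n) = W d n @ W d (n - (d - 1))"
  using W_Suc[of d n] sigma_pow_two(2)[of d n] by auto

section \<open>Bispecial words\<close>

text \<open>The inverse of \<open>l d m\<close>, written from the longest factor down. Exponents
  drop by d - 1, since a nonempty \<open>bispecial d (n - (d - 2))\<close> starts with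
  \<open>W d (n - (d - 1))\<close>; for n at most d - 2 the truncated subtraction ends the
  recursion.\<close>

fun bispecial :: "nat \<Rightarrow> nat \<Rightarrow> nat sword" where
  "bispecial d 0 = []"
| "bispecial d (Suc n) = W d n @ bispecial d (n - (d - 2))"

lemma positive_bispecial: "positive (bispecial d n)"
  by (induction d n rule: bispecial.induct) auto

lemma l_formula:
  assumes "d \<ge> 3"
  shows "l d (Suc n) =
    fg_prod (map (\<lambda>i. fg_inv (W d (n mod (d - 1) + i * (d - 1)))) [0..<n div (d - 1) + 1])"
proof (cases "Suc n \<le> d - 1")
  case True
  then show ?thesis
    by (simp add: l_def sigma_pow_neg[unfolded One_nat_def] fg_prod_eq reduce_fg_inv_positive)
next
  case False
  then show ?thesis by (simp add: l_def sigma_pow_neg[unfolded One_nat_def])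
qed

lemma l_eq:
  assumes "d \<ge> 3"
  shows "l d m = fg_inv (bispecial d m)"
proof -
  have "concat (map (\<lambda>i. fg_inv (W d (n mod (d - 1) + i * (d - 1)))) [0..<n div (d - 1) + 1])
      = fg_inv (bispecial d (Suc n))" for n
  proof (induction n rule: less_induct)
    case (less n)
    show ?case
    proof (cases "n < d - 1")
      case True
      then show ?thesis by (simp add: fg_inv_append)
    next
      case False
      \<comment> \<open>Passing from n to n - (d - 1) keeps the residue and removes the last factor,
        which inversion turns into the first one.\<close>
      define n' where "n' = n - (d - 1)"
      have n: "n = n' + (d - 1)" using False by (simp add: n'_def)
      have "n' < n" using n assms by simp
      have q: "n div (d - 1) = Suc (n' div (d - 1))"
        unfolding n'_def by (rule le_div_geq) (use False assms in auto)
      have m: "n mod (d - 1) = n' mod (d - 1)"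
        unfolding n'_def by (rule le_mod_geq) (use False in auto)
      have k: "n' mod (d - 1) + Suc (n' div (d - 1)) * (d - 1) = n"
        unfolding m[symmetric] q[symmetric] by (rule mod_div_mult_eq)
      have n'': "n - (d - 2) = Suc n'" using n assms by simp
      let ?f = "\<lambda>i. fg_inv (W d (n' mod (d - 1) + i * (d - 1)))"
      have "concat (map ?f [0..<Suc (n' div (d - 1)) + 1])
          = concat (map ?f [0..<n' div (d - 1) + 1]) @ ?f (Suc (n' div (d - 1)))"
        by simp
      also have "\<dots> = fg_inv (bispecial d (Suc n))"
        unfolding less.IH[OF \<open>n' < n\<close>] k bispecial.simps(2)[of d n] n'' fg_inv_append ..
      finally show ?thesis unfolding m q .
    qed
  qed
  then show ?thesis
    using assms by (cases m)
      (auto simp: l_formula fg_prod_eq reduce_fg_inv_positive positive_bispecial l_def[of d 0]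
        simp del: bispecial.simps(2) upt_Suc)
qed

text \<open>It suffices to compare neighbours. For n at least d - 1, the recurrence shows that the
  words of indices n + 1 and n + 2 both start with \<open>W d (Suc n)\<close>; what remains are two
  words of the same kind with smaller indices.\<close>

lemma bispecial_mono:
  assumes "d \<ge> 3"
  shows "i \<le> m \<Longrightarrow> prefix (bispecial d i) (bispecial d m)"
proof (induction m arbitrary: i rule: less_induct)
  case (less m)
  show ?case
  proof (cases "i = m")
    case False
    with less.prems obtain m' where m: "m = Suc m'" "i \<le> m'" by (cases m) auto
    have "prefix (bispecial d m') (bispecial d (Suc m'))"
    proof (cases m')
      case (Suc n)
      show ?thesis
      proof (cases "n < d - 1")
        case True
        then show ?thesis using Suc assms by (simp add: W_Suc_small)
      next
        case False
        then have *: "n - (d - 2) = Suc (n - (d - 1))" using assms by simp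
        have "prefix (bispecial d (n - (d - 1) - (d - 2))) (bispecial d (m' - (d - 2)))"
          using m Suc assms by (intro less.IH) auto
        then show ?thesis
          using False Suc assms by (simp add: W_Suc_large *)
      qed
    qed simp
    then show ?thesis
      using less.IH[of m' i] m by (auto intro: prefix_order.trans)
  qed simp
qed

section \<open>Admissible words\<close>

text \<open>
  The index \<open>s\<close> is the stage of appearance plus \<open>d - 2\<close>: this makes the index of the empty word
  zero, and a branch vertex of index \<open>s\<close> has exactly one outgoing edge of colour 2 in \<open>T d n\<close> for
  \<open>s \<le> n \<le> s + d - 1\<close> and none otherwise.
\<close>

inductive adm :: "nat \<Rightarrow> nat \<Rightarrow> nat sword \<Rightarrow> bool" for d where
  adm_Nil: "adm d 0 []"
| adm_step: "adm d s u \<Longrightarrow> s \<le> n \<Longrightarrow> n \<le> s + d - 1 \<Longrightarrow> adm d (n + d - 1) (W d n @ u)"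

lemma positive_adm: "adm d s u \<Longrightarrow> positive u"
  by (induction rule: adm.induct) auto

text \<open>The bound on \<open>s\<close> says that the stage is at most \<open>m\<close>. Each step
  prepends \<open>W d n\<close> to a prefix of \<open>bispecial d (n - (d - 2))\<close>, which gives
  a prefix of \<open>bispecial d (Suc n)\<close>.\<close>

lemma adm_prefix:
  assumes "d \<ge> 3" "adm d s u" "s \<le> m + (d - 2)"
  shows "prefix u (bispecial d m)"
  using assms(2,3)
proof (induction arbitrary: m rule: adm.induct)
  case (adm_step s u n)
  have "prefix u (bispecial d (n - (d - 2)))"
    using adm_step by (intro adm_step.IH) auto
  then have "prefix (W d n @ u) (bispecial d (Suc n))" by simp
  moreover have "Suc n \<le> m" using adm_step.prems assms(1) by simp
  ultimately show ?case
    using bispecial_mono[OF assms(1)] prefix_order.trans by blast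
qed simp

text \<open>Greedy choice: for n at least d - 1 the word \<open>bispecial d (n - (d - 2))\<close> is
  admissible with index n, so \<open>W d n\<close> is prepended at the first moment that
  \<open>adm_step\<close> allows.\<close>

lemma adm_bispecial:
  assumes "d \<ge> 3"
  shows "adm d (n + d - 1) (bispecial d (Suc n))"
proof (induction n rule: less_induct)
  case (less n)
  show ?case
  proof (cases "n < d - 1")
    case True
    then have "n - (d - 2) = 0" by simp
    then show ?thesis using adm_step[OF adm_Nil, of n d] True by simp
  next
    case False
    then have *: "n - (d - 2) = Suc (n - (d - 1))" using assms by simp
    have "adm d n (bispecial d (n - (d - 2)))"
      using less.IH[of "n - (d - 1)"] False assms unfolding * by simp
    then show ?thesis using adm_step[of d n _ n] assms by simp
  qed
qed

text \<open>
  A prefix of \<open>bispecial d (Suc n)\<close> that is longer than \<open>bispecial d n\<close> starts with \<open>W d n\<close>, and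
  its remaining part is too long to be admissible with an index below \<open>n - (d - 1)\<close>.
\<close>

lemma prefix_adm:
  assumes d: "d \<ge> 3"
  shows "prefix p (bispecial d m) \<Longrightarrow> \<exists>s. s \<le> m + (d - 2) \<and> adm d s p"
proof (induction m arbitrary: p rule: less_induct)
  case (less m)
  show ?case
  proof (cases m)
    case 0
    then show ?thesis using less.prems adm_Nil by auto
  next
    case (Suc n)
    show ?thesis
    proof (cases "prefix p (bispecial d n)")
      case True
      then obtain s where "s \<le> n + (d - 2)" "adm d s p" using less.IH Suc by blast
      then show ?thesis using Suc by (intro exI[of _ s]) simp
    next
      case False
      have pm: "prefix p (bispecial d (Suc n))" using less.prems Suc by simp
      moreover have "prefix (bispecial d n) (bispecial d (Suc n))" by (rule bispecial_mono[OF d]) simp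
      ultimately have len: "length p > length (bispecial d n)"
        using False by (meson not_le prefix_length_prefix)
      \<comment> \<open>For n at least d, \<open>bispecial d n\<close> equals
        \<open>W d n @ bispecial d (n - (2 * d - 2))\<close>; for smaller n it is
        \<open>W d n\<close> without its last letter.\<close>
      have split: "length p \<ge> length (W d n) \<and>
        (n \<ge> d \<longrightarrow> length p > length (W d n) + length (bispecial d (n - (2 * d - 2))))"
      proof (cases n)
        case 0
        then show ?thesis using len d by (cases p) (simp_all add: W_0)
      next
        case (Suc k)
        show ?thesis
        proof (cases "k < d - 1")
          case True
          then show ?thesis using len d Suc by (auto simp: W_Suc_small)
        next
          case False
          then have *: "k - (d - 2) = Suc (k - (d - 1))" using d by simp
          have **: "k - (d - 1) - (d - 2) = n - (2 * d - 2)" using Suc d by simp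
          show ?thesis using len d Suc False unfolding ** [symmetric]
            by (simp add: W_Suc_large *)
        qed
      qed
      have "prefix (W d n) p"
        using pm split by (metis bispecial.simps(2) prefix_def prefix_length_prefix)
      then obtain q where p: "p = W d n @ q" by (auto simp: prefix_def)
      have "prefix q (bispecial d (n - (d - 2)))" using pm p by simp
      moreover have "n - (d - 2) < m" using Suc by simp
      ultimately obtain s where s: "s \<le> n - (d - 2) + (d - 2)" "adm d s q"
        using less.IH by blast
      show ?thesis
      proof (cases "n < d - 1")
        case True
        then have "q = []" using \<open>prefix q _\<close> by simp
        then show ?thesis
          using adm_step[OF adm_Nil, of n d] True Suc p by (intro exI[of _ "n + d - 1"]) simp
      next
        case False
        \<comment> \<open>Otherwise s is at most n - d, and \<open>adm_prefix\<close> makes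
          \<open>q\<close> a prefix of \<open>bispecial d (n - (2 * d - 2))\<close>, against the
          second bound of \<open>split\<close>.\<close>
        have "n \<le> s + d - 1"
        proof (rule ccontr)
          assume not: "\<not> n \<le> s + d - 1"
          then have "n \<ge> d" by simp
          then have "length q > length (bispecial d (n - (2 * d - 2)))"
            using split p by simp
          moreover have "prefix q (bispecial d (n - (2 * d - 2)))"
            by (rule adm_prefix[OF d s(2)]) (use not in auto)
          ultimately show False using prefix_length_le by fastforce
        qed
        then have "adm d (n + d - 1) p"
          unfolding p using s False by (intro adm_step[of d s]) auto
        then show ?thesis using Suc by (intro exI[of _ "n + d - 1"]) simp
      qed
    qed
  qed
qed

section \<open>Vertices of the trees\<close>

lemma T_0: "T d 0 = T0 d"
  by (simp add: T_def)

lemma T_Suc: "T d (Suc n) = tau d (T d n)"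
  by (simp add: T_def)

lemma fresh_inv_T: "fresh_inv (T d n)"
proof (induction n)
  case 0
  show ?case by (auto simp: T_def T0_def fresh_inv_def verts_def)
next
  case (Suc n)
  then show ?case by (simp add: T_Suc fresh_inv_tau)
qed

lemma edge_verts: "(x, y, i) \<in> E \<Longrightarrow> x \<in> verts E" "(x, y, i) \<in> E \<Longrightarrow> y \<in> verts E"
  by (auto simp: verts_def)

lemma verts_T_mono: "m \<le> n \<Longrightarrow> verts (T d m) \<subseteq> verts (T d n)"
  by (rule lift_Suc_mono_le[of "\<lambda>n. verts (T d n)"]) (simp_all add: T_Suc verts_mono_tau)

text \<open>Colours run through 2d-2, ..., d+1, 1, d, ..., 3, 2; an edge that has reached 2 is
  split.\<close>

fun next_colour :: "nat \<Rightarrow> nat \<Rightarrow> nat" where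
  "next_colour d j = (if j = 1 then d else if j = d + 1 then 1 else j - 1)"

lemma tau_keep: "(x, y, j) \<in> E \<Longrightarrow> j \<noteq> 2 \<Longrightarrow> (x, y, next_colour d j) \<in> tau d E"
  by (force simp: tau_def)

lemma tau_split:
  assumes "(x, y, 2) \<in> E"
  shows "(New x y 0, x, d) \<in> tau d E" "(New x y 0, y, 1) \<in> tau d E"
    and "1 \<le> h \<Longrightarrow> h \<le> d - 2 \<Longrightarrow> (New x y 0, New x y h, d + h) \<in> tau d E"
  using assms by (force simp: tau_def)+

lemma in_T_Suc_cases:
  assumes "(x, y, i) \<in> T d (Suc n)"
  obtains (keep) j where "(x, y, j) \<in> T d n" "j \<noteq> 2" "i = next_colour d j"
  | (source) b where "(y, b, 2) \<in> T d n" "x = New y b 0" "i = d"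
  | (target) a where "(a, y, 2) \<in> T d n" "x = New a y 0" "i = 1"
  | (leaf) a b h where "(a, b, 2) \<in> T d n" "x = New a b 0" "y = New a b h" "1 \<le> h" "h \<le> d - 2"
      "i = d + h"
  using assms unfolding T_Suc tau_def by (auto split: if_splits)

lemma verts_T_Suc_cases:
  assumes "v \<in> verts (T d (Suc n))"
  obtains (old) "v \<in> verts (T d n)"
  | (new) a b h where "(a, b, 2) \<in> T d n" "v = New a b h" "h \<le> d - 2"
proof -
  obtain x y i where e: "(x, y, i) \<in> T d (Suc n)" and v: "v = x \<or> v = y"
    using assms by (auto simp: verts_def)
  from e show thesis
    by (cases rule: in_T_Suc_cases) (use v in \<open>auto intro: that edge_verts\<close>)
qed

lemma New_in_verts:
  assumes "(x, y, 2) \<in> T d n" "h \<le> d - 2"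
  shows "New x y h \<in> verts (T d (Suc n))"
proof (cases "h = 0")
  case True
  then show ?thesis using tau_split(1)[OF assms(1)] by (auto simp: T_Suc intro: edge_verts)
next
  case False
  then show ?thesis using tau_split(3)[OF assms(1), of h d] assms(2)
    by (auto simp: T_Suc intro: edge_verts)
qed

lemma colour_range:
  assumes "d \<ge> 3" "(x, y, i) \<in> T d n"
  shows "1 \<le> i \<and> i \<le> 2 * d - 2"
  using assms(2)
proof (induction n arbitrary: x y i)
  case 0
  then show ?case using assms(1) by (auto simp: T_0 T0_def)
next
  case (Suc n)
  from Suc.prems show ?case
  proof (cases rule: in_T_Suc_cases)
    case (keep j)
    then show ?thesis using Suc.IH[OF keep(1)] assms(1) by auto
  qed (use assms(1) in auto)
qed

section \<open>Stage of creation and syntactic form of a vertex\<close>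

definition stage :: "nat \<Rightarrow> vertex \<Rightarrow> nat" where
  "stage d v = (LEAST n. v \<in> verts (T d n))"

lemma stage_eq:
  assumes "v \<in> verts (T d (Suc n))" "v \<notin> verts (T d n)"
  shows "stage d v = Suc n"
  unfolding stage_def
proof (rule Least_equality)
  fix m assume "v \<in> verts (T d m)"
  then show "Suc n \<le> m" using assms(2) verts_T_mono[of m n d] by (meson not_less_eq_eq subsetD)
qed (fact assms(1))

lemma stage_New: "(x, y, 2) \<in> T d n \<Longrightarrow> h \<le> d - 2 \<Longrightarrow> stage d (New x y h) = Suc n"
  by (intro stage_eq New_in_verts New_fresh)

lemma stage_le: "v \<in> verts (T d n) \<Longrightarrow> stage d v \<le> n"
  by (simp add: stage_def Least_le)

text \<open>Describes the branch vertices, by \<open>branch_verts_eq\<close>: the root and the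
  centres z of splits, as opposed to the leaves x_j and z_h.\<close>

primrec hub :: "vertex \<Rightarrow> bool" where
  "hub (Base j) \<longleftrightarrow> j = 0"
| "hub (New x y h) \<longleftrightarrow> h = 0"

lemma hub_source: "(x, y, i) \<in> T d n \<Longrightarrow> hub x"
proof (induction n arbitrary: x y i)
  case 0
  then show ?case by (auto simp: T_0 T0_def)
next
  case (Suc n)
  from Suc.prems show ?case
    by (cases rule: in_T_Suc_cases) (use Suc.IH in auto)
qed

section \<open>Degrees\<close>

definition incident :: "edge set \<Rightarrow> vertex \<Rightarrow> edge set" where
  "incident E v = {(x, y, i). (x, y, i) \<in> E \<and> (v = x \<or> v = y)}"

text \<open>The edge at \<open>v\<close> among the edges that replace a given edge at \<open>v\<close>.\<close>

fun successor :: "nat \<Rightarrow> vertex \<Rightarrow> edge \<Rightarrow> edge" where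
  "successor d v (x, y, i) =
    (if i = 2 then (if v = x then (New x y 0, x, d) else (New x y 0, y, 1))
     else (x, y, next_colour d i))"

text \<open>Recolouring keeps endpoints, and a split leaves exactly one new edge at each old end, so
  \<open>successor d v\<close> is a bijection between the edges at \<open>v\<close> in the two
  trees.\<close>

lemma degree_old:
  assumes v: "v \<in> verts (T d n)"
  shows "degree (T d (Suc n)) v = degree (T d n) v"
proof -
  have fr: "(x, y, i) \<notin> T d n" if "New x y h \<in> verts (T d n)" for x y h i
    using that fresh_inv_T[of d n] by (auto simp: fresh_inv_def)
  have un: "i = j" if "(x, y, i) \<in> T d n" "(x, y, j) \<in> T d n" for x y i j
    using that fresh_inv_T[of d n] by (auto simp: fresh_inv_def)
  have new: "New x y h \<notin> verts (T d n)" if "(x, y, 2) \<in> T d n" for x y h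
    using that fr by blast
  have nov: "New x y h \<noteq> v" if "(x, y, 2) \<in> T d n" for x y h
    using that v new by blast
  have noe: "(New x y h, z, i) \<notin> T d n" if "(x, y, 2) \<in> T d n" for x y h z i
    using that new edge_verts by blast
  have "inj_on (successor d v) (incident (T d n) v)"
    by (rule inj_onI) (auto simp: incident_def split: if_splits dest: un noe simp del: next_colour.simps)
  moreover have "successor d v ` incident (T d n) v = incident (T d (Suc n)) v"
  proof (intro equalityI subsetI)
    fix e assume "e \<in> successor d v ` incident (T d n) v"
    then obtain x y i where "(x, y, i) \<in> T d n" "v = x \<or> v = y" "e = successor d v (x, y, i)"
      by (auto simp: incident_def)
    then show "e \<in> incident (T d (Suc n)) v"
      using tau_keep[of x y i "T d n" d] tau_split(1,2)[of x y "T d n" d]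
      by (auto simp: incident_def T_Suc simp del: next_colour.simps)
  next
    fix e assume "e \<in> incident (T d (Suc n)) v"
    then obtain x y i where e: "e = (x, y, i)" "(x, y, i) \<in> T d (Suc n)" "v = x \<or> v = y"
      by (auto simp: incident_def)
    from e(2) show "e \<in> successor d v ` incident (T d n) v"
    proof (cases rule: in_T_Suc_cases)
      case (keep j)
      then show ?thesis using e
        by (intro image_eqI[of _ _ "(x, y, j)"]) (auto simp: incident_def)
    next
      case (source b)
      then show ?thesis using e nov[OF source(1)]
        by (intro image_eqI[of _ _ "(y, b, 2)"]) (auto simp: incident_def)
    next
      case (target a)
      have "y \<noteq> a" using target(1) fresh_inv_T[of d n] by (auto simp: fresh_inv_def)
      then show ?thesis using e target nov[OF target(1)]
        by (intro image_eqI[of _ _ "(a, y, 2)"]) (auto simp: incident_def)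
    next
      case (leaf a b h)
      then show ?thesis using e nov[OF leaf(1)] by auto
    qed
  qed
  ultimately have "card (incident (T d (Suc n)) v) = card (incident (T d n) v)"
    by (metis card_image)
  then show ?thesis by (simp add: degree_def incident_def)
qed

lemma degree_new:
  assumes d: "d \<ge> 3" and e: "(a, b, 2) \<in> T d n" and h: "h \<le> d - 2"
  shows "degree (T d (Suc n)) (New a b h) = (if h = 0 then d else 1)"
proof -
  have new: "New a b k \<notin> verts (T d n)" for k
    using New_fresh[OF e] .
  have noe: "(New a b k, z, i) \<notin> T d n" "(z, New a b k, i) \<notin> T d n" for k z i
    using new edge_verts by blast+
  have ab: "a \<noteq> b" using e fresh_inv_T[of d n] by (auto simp: fresh_inv_def)
  show ?thesis
  proof (cases "h = 0")
    case True
    \<comment> \<open>Enumerates the edges at the centre: 0 and 1 give the two halves of the split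
      edge, and k from 2 to d - 1 gives the leaf edge to z_(k-1).\<close>
    define f where "f k = (New a b 0, if k = 0 then a else if k = 1 then b else New a b (k - 1),
      if k = 0 then d else if k = 1 then 1 else d + (k - 1))" for k
    have "incident (T d (Suc n)) (New a b h) = f ` {..<d}"
    proof (intro equalityI subsetI)
      fix e' assume "e' \<in> incident (T d (Suc n)) (New a b h)"
      then obtain x y i where e': "e' = (x, y, i)" "(x, y, i) \<in> T d (Suc n)"
        "New a b h = x \<or> New a b h = y"
        by (auto simp: incident_def)
      from e'(2) show "e' \<in> f ` {..<d}"
      proof (cases rule: in_T_Suc_cases)
        case (keep j)
        then show ?thesis using e' noe by auto
      next
        case (source c)
        then show ?thesis using e' noe d True
          by (intro image_eqI[of _ _ 0]) (auto simp: f_def)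
      next
        case (target c)
        then show ?thesis using e' noe d True
          by (intro image_eqI[of _ _ 1]) (auto simp: f_def)
      next
        case (leaf a' b' k)
        then show ?thesis using e' d True
          by (intro image_eqI[of _ _ "k + 1"]) (auto simp: f_def)
      qed
    next
      fix e' assume "e' \<in> f ` {..<d}"
      then obtain k where k: "k < d" "e' = f k" by auto
      have "e' \<in> T d (Suc n)"
        using tau_split(1,2)[OF e, of d] tau_split(3)[OF e, of "k - 1" d] k
        by (auto simp: f_def T_Suc)
      then show "e' \<in> incident (T d (Suc n)) (New a b h)"
        using k True by (auto simp: incident_def f_def)
    qed
    moreover have "inj_on f {..<d}"
      using ab by (auto simp: inj_on_def f_def split: if_splits)
    ultimately have "card (incident (T d (Suc n)) (New a b h)) = d"
      by (simp add: card_image)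
    then show ?thesis using True by (simp add: degree_def incident_def)
  next
    case False
    have "incident (T d (Suc n)) (New a b h) = {(New a b 0, New a b h, d + h)}"
    proof (intro equalityI subsetI)
      fix e' assume "e' \<in> incident (T d (Suc n)) (New a b h)"
      then obtain x y i where e': "e' = (x, y, i)" "(x, y, i) \<in> T d (Suc n)"
        "New a b h = x \<or> New a b h = y"
        by (auto simp: incident_def)
      from e'(2) show "e' \<in> {(New a b 0, New a b h, d + h)}"
        by (cases rule: in_T_Suc_cases) (use e' noe False in auto)
    next
      fix e' assume "e' \<in> {(New a b 0, New a b h, d + h)}"
      then show "e' \<in> incident (T d (Suc n)) (New a b h)"
        using tau_split(3)[OF e, of h d] h False by (auto simp: incident_def T_Suc)
    qed
    then show ?thesis using False by (simp add: degree_def incident_def)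
  qed
qed

lemma degree_T:
  assumes d: "d \<ge> 3"
  shows "v \<in> verts (T d n) \<Longrightarrow> degree (T d n) v = (if hub v then d else 1)"
proof (induction n arbitrary: v)
  case 0
  then obtain j where j: "v = Base j" "j \<le> d" by (auto simp: T_0 T0_def verts_def)
  show ?case
  proof (cases "j = 0")
    case True
    have "incident (T d 0) v = (\<lambda>j. (Base 0, Base j, j)) ` {1..d}"
      using True j by (auto simp: incident_def T_0 T0_def)
    moreover have "inj_on (\<lambda>j. (Base 0, Base j, j)) {1..d}" by (auto simp: inj_on_def)
    ultimately have "card (incident (T d 0) v) = d" by (simp add: card_image)
    then show ?thesis using True j by (simp add: degree_def incident_def)
  next
    case False
    have "incident (T d 0) v = {(Base 0, Base j, j)}"
      using False j by (auto simp: incident_def T_0 T0_def)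
    then show ?thesis using False j by (simp add: degree_def incident_def)
  qed
next
  case (Suc n)
  from Suc.prems show ?case
  proof (cases rule: verts_T_Suc_cases)
    case old
    then show ?thesis using Suc.IH degree_old by simp
  next
    case (new a b h)
    then show ?thesis using degree_new[OF d] by simp
  qed
qed

lemma branch_verts_eq: "d \<ge> 3 \<Longrightarrow> branch_verts d n = {v \<in> verts (T d n). hub v}"
  by (auto simp: branch_verts_def degree_T split: if_splits)

section \<open>The map to the free group\<close>

text \<open>
  Extends \<open>f0\<close> to all vertices. Along an edge of colour \<open>i\<close> of \<open>T d n\<close> it is multiplied by
  \<open>\<sigma>\<^sup>n(p\<^sub>*(i))\<close>, so every walk, not only the shortest path, computes it.
\<close>

fun potential :: "nat \<Rightarrow> vertex \<Rightarrow> nat sword" where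
  "potential d (Base j) = (if j = 0 then [] else [(j, True)])"
| "potential d (New x y h) =
    (let n = stage d (New x y h) in
      fg_mult (fg_mult (potential d x) (fg_inv (W d (n - 1)))) (if h = 0 then [] else W d (n + h)))"

lemma reduce_potential [simp]: "reduce (potential d v) = potential d v"
  by (cases v) (auto simp: Let_def reduce_positive)

text \<open>One application of sigma undoes the recolouring, so an edge that is not split carries
  the same group element at consecutive stages.\<close>

lemma sigma_p_next_colour:
  assumes "d \<ge> 3" "1 \<le> j" "j \<le> 2 * d - 2" "j \<noteq> 2"
  shows "sigma d (p_letter d (next_colour d j)) = p_letter d j"
proof -
  consider "j = 1" | "3 \<le> j" "j \<le> d" | "j = d + 1" | "j \<ge> d + 2" using assms by linarith
  then show ?thesis
  proof cases
    case 4
    then obtain k where "j = Suc (Suc d) + k" using le_Suc_ex by (metis add_2_eq_Suc')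
    then show ?thesis by (simp add: p_letter_def)
  qed (use assms in \<open>auto simp: p_letter_def sigma_letter_pos sigma_letter_def\<close>)
qed

lemma fg_mult_cancel: "reduce v = v \<Longrightarrow> fg_mult (fg_mult v (fg_inv u)) u = v"
  by (simp add: fg_mult_assoc fg_mult_inv_left fg_mult_Nil)

lemma potential_edge:
  assumes d: "d \<ge> 3"
  shows "(x, y, i) \<in> T d n \<Longrightarrow>
    potential d y = fg_mult (potential d x) ((sigma d ^^ n) (p_letter d i))"
proof (induction n arbitrary: x y i)
  case 0
  then show ?case by (auto simp: T_0 T0_def p_letter_def fg_mult_Nil reduce_positive)
next
  case (Suc n)
  from Suc.prems show ?case
  proof (cases rule: in_T_Suc_cases)
    case (keep j)
    then show ?thesis
      using Suc.IH[OF keep(1)] sigma_p_next_colour[OF d] colour_range[OF d keep(1)]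
      by (simp del: next_colour.simps funpow.simps add: funpow_Suc_right)
  next
    case (source b)
    \<comment> \<open>The edge from the centre back to \<open>y\<close> carries
      \<open>W d n\<close>, whose inverse is the factor in the definition of
      \<open>potential\<close> at the centre.\<close>
    have "(sigma d ^^ Suc n) (p_letter d d) = (sigma d ^^ n) (sigma d [(d, True)])"
      by (simp add: p_letter_def funpow_swap1)
    also have "\<dots> = W d n"
      using d by (simp add: sigma_letter_pos sigma_letter_def W_def)
    finally have *: "(sigma d ^^ Suc n) (p_letter d d) = W d n" .
    show ?thesis
      unfolding source(2,3) *
      by (simp add: stage_New[OF source(1)] fg_mult_Nil fg_mult_cancel)
  next
    case (target a)
    have *: "(sigma d ^^ Suc n) (p_letter d 1) = W d (Suc n)"
      using d by (simp add: p_letter_def W_def)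
    have "potential d y = fg_mult (potential d a) ((sigma d ^^ n) [(2, True)])"
      using Suc.IH[OF target(1)] d by (simp add: p_letter_def)
    \<comment> \<open>The first factor leads from the centre back to \<open>a\<close>, the second
      one along the former edge from \<open>a\<close> to \<open>y\<close>.\<close>
    moreover have "W d (Suc n) = fg_mult (W d n) ((sigma d ^^ n) [(2, True)])"
      unfolding W_Suc by (simp add: fg_mult_def reduce_positive positive_sigma_pow)
    moreover have "potential d x = fg_mult (potential d a) (fg_inv (W d n))"
      unfolding target(2) by (simp add: stage_New[OF target(1)] fg_mult_Nil)
    ultimately show ?thesis
      unfolding target(3) * by (simp add: fg_mult_cancel flip: fg_mult_assoc)
  next
    case (leaf a b h)
    have "(sigma d ^^ Suc n) (p_letter d (d + h)) = W d (Suc n + h)"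
      using leaf(4) unfolding sigma_pow_W[symmetric] by (simp add: p_letter_def W_def)
    then show ?thesis
      using leaf by (simp add: stage_New[OF leaf(1)] fg_mult_Nil)
  qed
qed

lemma p_star_Cons:
  "p_star d ((i, s) # w) = fg_mult (if s then p_letter d i else fg_inv (p_letter d i)) (p_star d w)"
  by (simp add: p_star_def fg_lift_eq letter_image_def fg_mult_def)

lemma potential_walk:
  assumes d: "d \<ge> 3"
  shows "walk (T d n) x w y \<Longrightarrow>
    potential d y = fg_mult (potential d x) ((sigma d ^^ n) (p_star d w))"
proof (induction rule: walk.induct)
  case (walk_Nil x)
  then show ?case by (simp add: p_star_def fg_lift_eq fg_mult_Nil)
next
  case (walk_fwd x y i w z)
  then show ?case
    using potential_edge[OF d] by (simp add: p_star_Cons sigma_pow_mult fg_mult_assoc)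
next
  case (walk_bwd y x i w z)
  let ?p = "(sigma d ^^ n)"
  have "fg_mult (?p (p_letter d i)) (?p (fg_inv (p_letter d i))) = []"
    by (simp add: fg_mult_inv_right flip: sigma_pow_mult)
  then have "fg_mult (potential d x) (?p (fg_inv (p_letter d i))) = potential d y"
    using potential_edge[OF d walk_bwd.hyps(1)] by (simp add: fg_mult_assoc fg_mult_Nil)
  then show ?case
    using walk_bwd.IH by (simp add: p_star_Cons sigma_pow_mult flip: fg_mult_assoc)
qed

lemma walk_append: "walk E x u y \<Longrightarrow> walk E y v z \<Longrightarrow> walk E x (u @ v) z"
  by (induction rule: walk.induct) (auto intro: walk.intros)

lemma walk_edge: "(x, y, i) \<in> E \<Longrightarrow> walk E x [(i, True)] y" "(x, y, i) \<in> E \<Longrightarrow> walk E y [(i, False)] x"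
  by (auto intro: walk.intros)

lemma walk_tau_edge:
  assumes "(x, y, i) \<in> E"
  shows "\<exists>w. walk (tau d E) x w y" "\<exists>w. walk (tau d E) y w x"
proof -
  have "(\<exists>w. walk (tau d E) x w y) \<and> (\<exists>w. walk (tau d E) y w x)"
  proof (cases "i = 2")
    case True
    then have "(New x y 0, x, d) \<in> tau d E" "(New x y 0, y, 1) \<in> tau d E"
      using assms tau_split by blast+
    then show ?thesis using walk_edge walk_append by metis
  next
    case False
    then show ?thesis using tau_keep[OF assms] walk_edge by blast
  qed
  then show "\<exists>w. walk (tau d E) x w y" "\<exists>w. walk (tau d E) y w x" by auto
qed

lemma walk_tau: "walk E x w y \<Longrightarrow> \<exists>w. walk (tau d E) x w y"
proof (induction rule: walk.induct)
  case (walk_Nil x)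
  then show ?case using walk.walk_Nil by blast
qed (use walk_tau_edge walk_append in meson)+

text \<open>Guarantees that the \<open>ARG_MIN\<close> in \<open>gamma\<close> is taken over a
  nonempty set of walks, so that \<open>gamma\<close> is itself a walk.\<close>

lemma connected_T:
  "d \<ge> 3 \<Longrightarrow> v \<in> verts (T d n) \<Longrightarrow> \<exists>w. walk (T d n) (Base 0) w v"
proof (induction n arbitrary: v)
  case 0
  then obtain j where j: "v = Base j" "j \<le> d" by (auto simp: T_0 T0_def verts_def)
  show ?case
  proof (cases "j = 0")
    case True
    then show ?thesis using j walk_Nil by blast
  next
    case False
    then have "(Base 0, v, j) \<in> T d 0" using j by (auto simp: T_0 T0_def)
    then show ?thesis using walk_edge by blast
  qed
next
  case (Suc n)
  from Suc.prems(2) show ?case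
  proof (cases rule: verts_T_Suc_cases)
    case old
    then show ?thesis using Suc walk_tau unfolding T_Suc by blast
  next
    case (new a b h)
    obtain w where w: "walk (T d (Suc n)) (Base 0) w a"
      using Suc edge_verts(1)[OF new(1)] walk_tau unfolding T_Suc by blast
    have "walk (T d (Suc n)) a [(d, False)] (New a b 0)"
      unfolding T_Suc by (rule walk_edge(2)[OF tau_split(1)[OF new(1)]])
    then have z: "walk (T d (Suc n)) (Base 0) (w @ [(d, False)]) (New a b 0)"
      using w walk_append by blast
    show ?thesis
    proof (cases "h = 0")
      case True
      then show ?thesis using z new by auto
    next
      case False
      then have "walk (T d (Suc n)) (New a b 0) [(d + h, True)] v"
        unfolding T_Suc new(2) using new(3) by (intro walk_edge tau_split(3)[OF new(1)]) auto
      then show ?thesis using z walk_append by blast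
    qed
  qed
qed

lemma f0_eq_potential:
  assumes d: "d \<ge> 3" and x: "x \<in> branch_verts d n"
  shows "f0 d x = potential d x"
proof -
  define k where "k = (LEAST k. x \<in> branch_verts d k)"
  have "x \<in> branch_verts d k" unfolding k_def using x by (rule LeastI)
  then have "\<exists>w. walk (T d k) (Base 0) w x"
    using connected_T[OF d] by (auto simp: branch_verts_def)
  then have "walk (T d k) (Base 0) (gamma d k (Base 0) x) x"
    unfolding gamma_def by (metis arg_min_natI)
  from potential_walk[OF d this] show ?thesis
    by (simp add: f0_def k_def Let_def fg_mult_Nil reduce_sigma_pow p_star_def)
qed

section \<open>Stages of appearance\<close>

text \<open>The root gets index 0, as if created at stage -(d - 2). Its edges in
  \<open>T d 0\<close>, with delays 0 to d - 1, then fit the window that holds for every other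
  hub.\<close>

definition index :: "nat \<Rightarrow> vertex \<Rightarrow> nat" where
  "index d v = (if v = Base 0 then 0 else stage d v + (d - 2))"

text \<open>The number of steps after which an edge of the given colour has colour 2.\<close>

definition delay :: "nat \<Rightarrow> nat \<Rightarrow> nat" where
  "delay d i = (if i = 1 then d - 1 else if i \<le> d then i - 2 else i - 1)"

lemma index_le: "v \<in> verts (T d n) \<Longrightarrow> index d v \<le> n + (d - 2)"
  using stage_le by (auto simp: index_def)

lemma index_New: "(x, y, 2) \<in> T d n \<Longrightarrow> h \<le> d - 2 \<Longrightarrow> index d (New x y h) = Suc n + (d - 2)"
  by (simp add: index_def stage_New)

text \<open>\<open>n + delay d i\<close> is the stage at which the edge has colour 2, and
  recolouring does not change it. A centre created at stage n has outgoing delays d - 2 to 2d - 3,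
  which fill the window from its index to its index plus d - 1.\<close>

lemma outgoing_delay:
  assumes d: "d \<ge> 3"
  shows "(x, y, i) \<in> T d n \<Longrightarrow> index d x \<le> n + delay d i \<and> n + delay d i \<le> index d x + (d - 1)"
proof (induction n arbitrary: x y i)
  case 0
  then show ?case using d by (auto simp: T_0 T0_def index_def delay_def)
next
  case (Suc n)
  from Suc.prems show ?case
  proof (cases rule: in_T_Suc_cases)
    case (keep j)
    have "delay d j = Suc (delay d i)"
      using keep colour_range[OF d keep(1)] d by (auto simp: delay_def)
    then show ?thesis using Suc.IH[OF keep(1)] by simp
  qed (use d in \<open>auto simp: index_New delay_def\<close>)
qed

lemma outgoing_exists:
  assumes d: "d \<ge> 3"
  shows "\<lbrakk>v \<in> verts (T d n); hub v; 1 \<le> i; i \<le> 2 * d - 2;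
    index d v \<le> n + delay d i; n + delay d i \<le> index d v + (d - 1)\<rbrakk> \<Longrightarrow> \<exists>y. (v, y, i) \<in> T d n"
proof (induction n arbitrary: i)
  case 0
  then have "v = Base 0" by (auto simp: T_0 T0_def verts_def)
  moreover have "i \<le> d" using 0 calculation by (auto simp: index_def delay_def split: if_splits)
  ultimately show ?case using 0 by (auto simp: T_0 T0_def)
next
  case (Suc n)
  from Suc.prems(1) show ?case
  proof (cases rule: verts_T_Suc_cases)
    case old
    \<comment> \<open>The preimage of \<open>i\<close> under \<open>next_colour d\<close>.\<close>
    define j where "j = (if i = d then 1 else if i = 1 then d + 1 else i + 1)"
    \<comment> \<open>The top colour has no preimage: its delay 2d - 3 fits the window only at the
      stage of creation, and \<open>v\<close> is older.\<close>
    have "i < 2 * d - 2"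
    proof (rule ccontr)
      assume "\<not> i < 2 * d - 2"
      then have "delay d i = 2 * d - 3" using Suc.prems d by (auto simp: delay_def)
      then show False using Suc.prems index_le[OF old] d by auto
    qed
    then have j: "1 \<le> j" "j \<le> 2 * d - 2" "j \<noteq> 2" "delay d j = Suc (delay d i)" "next_colour d j = i"
      using Suc.prems d by (auto simp: j_def delay_def)
    then obtain y where "(v, y, j) \<in> T d n"
      using Suc.IH[of j] Suc.prems old by auto
    then show ?thesis using tau_keep[of v y j "T d n" d] j unfolding T_Suc by metis
  next
    case (new a b h)
    then have h: "h = 0" using Suc.prems by simp
    \<comment> \<open>Delays of at least d - 2 belong to the colours d, 1 and those above d, which
      are the colours at a new centre.\<close>
    have "d - 2 \<le> delay d i"
      using Suc.prems new index_New[of a b d n h] by simp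
    then consider "i = d" | "i = 1" | "i > d"
      using d Suc.prems(3) by (auto simp: delay_def split: if_splits)
    then show ?thesis
    proof cases
      case 3
      then have "1 \<le> i - d" "i - d \<le> d - 2" using Suc.prems by auto
      from tau_split(3)[OF new(1) this] show ?thesis using new h 3 unfolding T_Suc by auto
    qed (use tau_split(1,2)[OF new(1), of d] new h in \<open>auto simp: T_Suc\<close>)
  qed
qed

section \<open>Branch vertices as admissible words\<close>

lemma potential_New:
  assumes "(a, b, 2) \<in> T d n" "potential d a = fg_inv u" "positive u"
  shows "potential d (New a b 0) = fg_inv (W d n @ u)"
  using assms stage_New[OF assms(1), of 0]
  by (simp add: fg_mult_Nil fg_mult_def reduce_fg_inv_positive flip: fg_inv_append)

text \<open>The parent of a new centre is the source \<open>a\<close> of the split edge. Colour 2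
  has delay 0, so \<open>outgoing_delay\<close> yields exactly the window of
  \<open>adm_step\<close>.\<close>

lemma hub_adm:
  assumes d: "d \<ge> 3"
  shows "v \<in> verts (T d n) \<Longrightarrow> hub v \<Longrightarrow> \<exists>u. adm d (index d v) u \<and> potential d v = fg_inv u"
proof (induction n arbitrary: v)
  case 0
  then have "v = Base 0" by (auto simp: T_0 T0_def verts_def)
  then show ?case using adm_Nil by (auto simp: index_def intro!: exI[of _ "[]"])
next
  case (Suc n)
  from Suc.prems(1) show ?case
  proof (cases rule: verts_T_Suc_cases)
    case old
    then show ?thesis using Suc by blast
  next
    case (new a b h)
    then have h: "h = 0" using Suc.prems by simp
    obtain u where u: "adm d (index d a) u" "potential d a = fg_inv u"
      using Suc.IH[OF edge_verts(1)[OF new(1)] hub_source[OF new(1)]] by blast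
    have "adm d (n + d - 1) (W d n @ u)"
      using u(1) outgoing_delay[OF d new(1)] d by (intro adm_step) (auto simp: delay_def)
    moreover have "index d v = n + d - 1" using index_New[OF new(1,3)] new(2) d by simp
    ultimately show ?thesis
      using potential_New[OF new(1) u(2) positive_adm[OF u(1)]] new h by auto
  qed
qed

lemma adm_hub:
  assumes d: "d \<ge> 3"
  shows "adm d s u \<Longrightarrow> \<exists>v \<in> verts (T d (s - (d - 2))). hub v \<and> index d v = s \<and> potential d v = fg_inv u"
proof (induction rule: adm.induct)
  case adm_Nil
  have "(Base 0, Base 1, 1) \<in> T d 0" using d by (auto simp: T_0 T0_def)
  then show ?case using edge_verts(1) by (intro bexI[of _ "Base 0"]) (auto simp: index_def)
next
  case (adm_step s u n)
  then obtain v where v: "v \<in> verts (T d (s - (d - 2)))" "hub v" "index d v = s"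
    "potential d v = fg_inv u" by blast
  have "v \<in> verts (T d n)" using v(1) verts_T_mono[of "s - (d - 2)" n d] adm_step.hyps by (simp add: subset_iff)
  \<comment> \<open>Within the window there is an outgoing edge of colour 2; the centre of its split
    is the required child.\<close>
  then obtain y where y: "(v, y, 2) \<in> T d n"
    using outgoing_exists[OF d _ v(2), of n 2] v(3) adm_step.hyps d by (force simp: delay_def)
  have "n + d - 1 - (d - 2) = Suc n" using d by simp
  then have "New v y 0 \<in> verts (T d (n + d - 1 - (d - 2)))" using New_in_verts[OF y, of 0] by simp
  moreover have "index d (New v y 0) = n + d - 1" using index_New[OF y, of 0] d by simp
  ultimately show ?case
    using potential_New[OF y v(4) positive_adm[OF adm_step.hyps(1)]]
    by (intro bexI[of _ "New v y 0"]) auto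
qed

text \<open>Index 0 accounts for the conventional stage -(d - 2) of the empty word. All other
  indices have the form n + d - 1 and give the stages n + 1.\<close>

lemma appears_iff:
  assumes d: "d \<ge> 3"
  shows "appears d k w \<longleftrightarrow> (\<exists>s u. adm d s u \<and> k = int s - int (d - 2) \<and> w = fg_inv u)"
proof
  assume a: "appears d k w"
  show "\<exists>s u. adm d s u \<and> k = int s - int (d - 2) \<and> w = fg_inv u"
  proof (cases "k \<ge> 1")
    case True
    define n where "n = nat k - 1"
    have n: "k = int (Suc n)" "nat k = Suc n" using True by (auto simp: n_def)
    obtain x where x: "x \<in> branch_verts d (Suc n)" "x \<notin> verts (T d n)" "w = f0 d x"
      using a True n(2) by (auto simp: appears_def)
    have xv: "x \<in> verts (T d (Suc n))" "hub x" using x(1) branch_verts_eq[OF d] by auto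
    have "(Base 0, Base 1, 1) \<in> T d 0" using d by (auto simp: T_0 T0_def)
    then have "Base 0 \<in> verts (T d n)" using edge_verts(1) verts_T_mono[of 0 n d] by blast
    then have "x \<noteq> Base 0" using x(2) by blast
    then have "index d x = Suc n + (d - 2)"
      using stage_eq[OF xv(1) x(2)] by (simp add: index_def)
    moreover obtain u where "adm d (index d x) u" "potential d x = fg_inv u"
      using hub_adm[OF d xv] by blast
    ultimately show ?thesis
      using x(3) n(1) f0_eq_potential[OF d x(1)]
      by (intro exI[of _ "Suc n + (d - 2)"] exI[of _ u]) simp
  next
    case False
    then show ?thesis using a d adm_Nil[of d]
      by (intro exI[of _ 0] exI[of _ "[]"]) (auto simp: appears_def split: if_splits)
  qed
next
  assume "\<exists>s u. adm d s u \<and> k = int s - int (d - 2) \<and> w = fg_inv u"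
  then obtain s u where s: "adm d s u" "k = int s - int (d - 2)" "w = fg_inv u" by blast
  show "appears d k w"
  proof (cases "s = 0")
    case True
    then have "u = []" using s(1) d by (auto elim: adm.cases)
    then show ?thesis using True s d by (simp add: appears_def)
  next
    case False
    then obtain n where n: "s = n + d - 1" using s(1) by (auto elim: adm.cases)
    then have k: "k = int (Suc n)" "nat k = Suc n" and sn: "s - (d - 2) = Suc n" using s(2) d by auto
    obtain v where v: "v \<in> verts (T d (Suc n))" "hub v" "index d v = s" "potential d v = fg_inv u"
      using adm_hub[OF d s(1)] sn by auto
    \<comment> \<open>Vertices of \<open>T d n\<close> have index at most n + d - 2, one less than
      \<open>s\<close>.\<close>
    have "v \<notin> verts (T d n)" using index_le[of v d n] v(3) n d by auto
    moreover have "v \<in> branch_verts d (Suc n)" using v branch_verts_eq[OF d] by simp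
    ultimately show ?thesis
      using f0_eq_potential[OF d] v(4) s(3) k
      unfolding appears_def k(2) by (auto intro!: bexI[of _ v])
  qed
qed

lemma appears_Suc_iff:
  assumes d: "d \<ge> 3"
  shows "appears d (int (Suc n)) w \<longleftrightarrow> (\<exists>u. adm d (n + d - 1) u \<and> w = fg_inv u)"
proof -
  have "int (Suc n) = int s - int (d - 2) \<longleftrightarrow> s = n + d - 1" for s
    using d by auto
  then show ?thesis unfolding appears_iff[OF d] by auto
qed

theorem proposition3p16:
  fixes d :: nat
  assumes "d \<ge> 3"
  shows "(\<forall>m. 1 \<le> m \<and> m \<le> d - 1 \<longrightarrow> (\<forall>w. appears d (int m) w \<longleftrightarrow> w = l d m))
    \<and> (\<forall>m\<ge>d. appears d (int m) (l d m)
          \<and> (\<forall>w. appears d (int m) w \<and> w \<noteq> l d m \<longrightarrow> length w < length (l d m)))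
    \<and> (\<forall>m. \<forall>x \<in> branch_verts d m. suffix (f0 d x) (l d m))
    \<and> (\<forall>m w. suffix w (l d m) \<longrightarrow> (\<exists>k::int. k \<le> int m \<and> appears d k w))"
proof (intro conjI)
  note d = assms
  have l_appears: "appears d (int m) (l d m)" if "m \<ge> 1" for m
  proof -
    obtain n where m: "m = Suc n" using \<open>m \<ge> 1\<close> by (cases m) auto
    show ?thesis unfolding m appears_Suc_iff[OF d] l_eq[OF d] using adm_bispecial[OF d] by blast
  qed
  have appears_suffix: "suffix w (l d m)" if a: "appears d (int m) w" and "m \<ge> 1" for m w
  proof -
    obtain n where m: "m = Suc n" using \<open>m \<ge> 1\<close> by (cases m) auto
    then obtain u where u: "adm d (n + d - 1) u" "w = fg_inv u"
      using a unfolding m appears_Suc_iff[OF d] by blast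
    have "prefix u (bispecial d m)"
      by (rule adm_prefix[OF d u(1)]) (use m d in simp)
    then show ?thesis by (simp only: l_eq[OF d] suffix_fg_inv u(2))
  qed
  have shorter: "length w < length (l d m)"
    if "appears d (int m) w" "m \<ge> 1" "w \<noteq> l d m" for m w
    using appears_suffix[OF that(1,2)] that(3)
    by (simp add: suffix_length_less strict_suffix_def)
  show "\<forall>m\<ge>d. appears d (int m) (l d m)
          \<and> (\<forall>w. appears d (int m) w \<and> w \<noteq> l d m \<longrightarrow> length w < length (l d m))"
  proof (intro allI impI conjI)
    fix m assume "m \<ge> d"
    then have "m \<ge> 1" using d by simp
    then show "appears d (int m) (l d m)" by (rule l_appears)
    show "length w < length (l d m)" if "appears d (int m) w \<and> w \<noteq> l d m" for w
      using that shorter \<open>m \<ge> 1\<close> by blast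
  qed
  show "\<forall>m. 1 \<le> m \<and> m \<le> d - 1 \<longrightarrow> (\<forall>w. appears d (int m) w \<longleftrightarrow> w = l d m)"
  proof (intro allI impI iffI)
    fix m w assume m: "1 \<le> m \<and> m \<le> d - 1" and w: "appears d (int m) w"
    obtain n where n: "m = Suc n" using m by (cases m) auto
    obtain u where u: "adm d (n + d - 1) u" "w = fg_inv u"
      using w unfolding n appears_Suc_iff[OF d] by blast
    \<comment> \<open>A word of this index starts with \<open>W d n\<close>, and for m at most d - 1
      this is already the length of \<open>l d m\<close>, so nothing shorter can appear.\<close>
    from u(1) have "length (W d n) \<le> length u"
    proof (cases rule: adm.cases)
      case (adm_step s v k)
      then have "k = n" using d by simp
      then show ?thesis using adm_step by simp
    qed (use d in simp)
    moreover have "n - (d - 2) = 0" using m n by simp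
    then have "length (l d m) = length (W d n)" using n by (simp add: l_eq[OF d])
    ultimately have "\<not> length w < length (l d m)" using u(2) by simp
    then show "w = l d m" using shorter[OF w] m by blast
  next
    fix m w assume "1 \<le> m \<and> m \<le> d - 1" "w = l d m"
    then show "appears d (int m) w" using l_appears by blast
  qed
  show "\<forall>m. \<forall>x \<in> branch_verts d m. suffix (f0 d x) (l d m)"
  proof (intro allI ballI)
    fix m x assume x: "x \<in> branch_verts d m"
    then have xv: "x \<in> verts (T d m)" "hub x" using branch_verts_eq[OF d] by auto
    then obtain u where u: "adm d (index d x) u" "potential d x = fg_inv u"
      using hub_adm[OF d] by blast
    show "suffix (f0 d x) (l d m)"
      using adm_prefix[OF d u(1) index_le[OF xv(1)]] f0_eq_potential[OF d x]
      by (simp add: l_eq[OF d] suffix_fg_inv u(2))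
  qed
  show "\<forall>m w. suffix w (l d m) \<longrightarrow> (\<exists>k::int. k \<le> int m \<and> appears d k w)"
  proof (intro allI impI)
    fix m w assume "suffix w (l d m)"
    then have "prefix (fg_inv w) (bispecial d m)"
      using suffix_fg_inv[of "fg_inv w"] by (simp add: l_eq[OF d])
    then obtain s where s: "s \<le> m + (d - 2)" "adm d s (fg_inv w)"
      using prefix_adm[OF d] by blast
    \<comment> \<open>For \<open>s = 0\<close> this is the negative stage -(d - 2) of the empty
      word.\<close>
    have "appears d (int s - int (d - 2)) w"
      unfolding appears_iff[OF d] by (intro exI[of _ s] exI[of _ "fg_inv w"]) (simp add: s(2))
    moreover have "int s - int (d - 2) \<le> int m" using s(1) by linarith
    ultimately show "\<exists>k::int. k \<le> int m \<and> appears d k w" by blast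
  qed
qed

end
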